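(* Let $\mathcal{X}$ be a non-empty finite set and $N\geq1$ an integer. Let $\mathcal{A}\subseteq\mathcal{G}(\mathcal{X}^N)$ be a set of gambles on $\mathcal{X}^N$, and define its exchangeable natural extension $$\mathcal{E}_{\mathrm{ex}}^N(\mathcal{A}):=\bigcap\{\mathcal{R}\in\mathbb{D}_{\mathrm{ex}}(\mathcal{X}^N):\mathcal{A}\subseteq\mathcal{R}\}.$$ Then the following statements are equivalent: (i) $\mathcal{A}$ avoids non-positivity under exchangeability; (ii) $\mathcal{A}$ is included in some coherent and exchangeable set of gambles; (iii) $\mathcal{E}_{\mathrm{ex}}^N(\mathcal{A})\neq\mathcal{G}(\mathcal{X}^N)$; (iv) $\mathcal{E}_{\mathrm{ex}}^N(\mathcal{A})$ is a coherent and exchangeable set of gambles; (v) $\mathcal{E}_{\mathrm{ex}}^N(\mathcal{A})$ is the smallest coherent and exchangeable set of gambles that includes $\mathcal{A}$. When any (and hence all) of these equivalent statements hold, then $$\mathcal{E}_{\mathrm{ex}}^N(\mathcal{A})=\mathrm{posi}\bigl(\mathcal{D}_{\mathcal{U}_N}+[\mathcal{G}^+_0(\mathcal{X}^N)\cup\mathcal{A}]\bigr)=\mathcal{D}_{\mathcal{U}_N}+\mathcal{E}(\mathcal{A}).$$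
   Context: A gamble on a non-empty set $\Omega$ is a bounded function $\Omega\to\mathbb{R}$; $\mathcal{G}(\Omega)$ is the linear space of all gambles on $\Omega$. Write $f\geq g$ for the pointwise ordering, and $f>g$ iff $f\geq g$ and $f\neq g$; $\mathcal{G}^+_0(\Omega)=\{f:f>0\}$. For $\mathcal{A}\subseteq\mathcal{G}(\Omega)$, $\mathrm{posi}(\mathcal{A})=\{\sum_{k=1}^n\lambda_kf_k:n\geq1,f_k\in\mathcal{A},\lambda_k>0\}$. $\mathcal{A}$ avoids non-positivity if no $f\in\mathrm{posi}(\mathcal{A})$ satisfies $f\leq0$. A set $\mathcal{R}\subseteq\mathcal{G}(\Omega)$ is coherent if: $0\notin\mathcal{R}$; $f>0$ implies $f\in\mathcal{R}$; $f\in\mathcal{R}$ and $\lambda>0$ imply $\lambda f\in\mathcal{R}$; $f_1,f_2\in\mathcal{R}$ implies $f_1+f_2\in\mathcal{R}$. The natural extension $\mathcal{E}(\mathcal{A})$ is the intersection of all coherent subsets of $\mathcal{G}(\Omega)$ that include $\mathcal{A}$. Intersections of an empty collection of sets of gambles on $\Omega$ are taken to be $\mathcal{G}(\Omega)$. Sums of sets are Minkowski sums. Let $\mathcal{P}_N$ be the set of permutations $\pi$ of $\{1,\dots,N\}$; put $\pi(x_1,\dots,x_N)=(x_{\pi(1)},\dots,x_{\pi(N)})$, $\pi^tf=f\circ\pi$, and $\mathrm{ex}^N(f)=\frac1{N!}\sum_{\pi\in\mathcal{P}_N}\pi^tf$ for $f\in\mathcal{G}(\mathcal{X}^N)$. $\mathcal{D}_{\mathcal{U}_N}=\{f\in\mathcal{G}(\mathcal{X}^N):\mathrm{ex}^N(f)=0\}$,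 which equals the linear span of $\{f-\pi^tf:f\in\mathcal{G}(\mathcal{X}^N),\pi\in\mathcal{P}_N\}$. A coherent set $\mathcal{R}\subseteq\mathcal{G}(\mathcal{X}^N)$ is exchangeable if $\mathcal{D}_{\mathcal{U}_N}+\mathcal{R}\subseteq\mathcal{R}$; $\mathbb{D}_{\mathrm{ex}}(\mathcal{X}^N)$ is the set of all coherent and exchangeable $\mathcal{R}\subseteq\mathcal{G}(\mathcal{X}^N)$. A set $\mathcal{A}\subseteq\mathcal{G}(\mathcal{X}^N)$ avoids non-positivity under exchangeability if $[\mathcal{G}^+_0(\mathcal{X}^N)\cup\mathcal{A}]+\mathcal{D}_{\mathcal{U}_N}$ avoids non-positivity. *)

theory Defs
  imports
    "HOL-Analysis.Analysis"
    "HOL-Library.Function_Algebras"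
    "HOL-Library.Set_Algebras"
begin

section \<open>Gambles and coherence\<close>

text \<open>
  A gamble on a set \<open>\<Omega>\<close> is represented by the total function that extends it by zero outside
  \<open>\<Omega>\<close>. Gambles on \<open>\<Omega>\<close> thus form a linear space under the pointwise operations, and for them the
  library's function orders \<open>\<le>\<close> and \<open><\<close> are the pointwise order on \<open>\<Omega>\<close> and its strict part
  (\<open>f \<le> g\<close> and \<open>f \<noteq> g\<close>).
\<close>

definition gambles :: "'w set \<Rightarrow> ('w \<Rightarrow> real) set" where
  "gambles \<Omega> = {f. bounded (f ` \<Omega>) \<and> (\<forall>\<omega>. \<omega> \<notin> \<Omega> \<longrightarrow> f \<omega> = 0)}"

definition pos_gambles :: "'w set \<Rightarrow> ('w \<Rightarrow> real) set" where
  "pos_gambles \<Omega> = {f \<in> gambles \<Omega>. f > 0}"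

definition posi :: "('w \<Rightarrow> real) set \<Rightarrow> ('w \<Rightarrow> real) set" where
  "posi A = {(\<lambda>\<omega>. \<Sum>k=1..n. l k * f k \<omega>) | (n :: nat) (l :: nat \<Rightarrow> real) (f :: nat \<Rightarrow> 'w \<Rightarrow> real).
     n \<ge> 1 \<and> (\<forall>k\<in>{1..n}. f k \<in> A \<and> l k > 0)}"

definition avoids_nonpositivity :: "('w \<Rightarrow> real) set \<Rightarrow> bool" where
  "avoids_nonpositivity A \<longleftrightarrow> \<not> (\<exists>f\<in>posi A. f \<le> 0)"

definition coherent :: "'w set \<Rightarrow> ('w \<Rightarrow> real) set \<Rightarrow> bool" where
  "coherent \<Omega> R \<longleftrightarrow>
     R \<subseteq> gambles \<Omega> \<and>
     0 \<notin> R \<and>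
     (\<forall>f\<in>gambles \<Omega>. f > 0 \<longrightarrow> f \<in> R) \<and>
     (\<forall>f\<in>R. \<forall>c::real. c > 0 \<longrightarrow> (\<lambda>\<omega>. c * f \<omega>) \<in> R) \<and>
     (\<forall>f\<in>R. \<forall>g\<in>R. f + g \<in> R)"

text \<open>
  The intersection of a family of sets of gambles on \<open>\<Omega>\<close>; the empty family yields all gambles.
\<close>

definition gamble_Inter :: "'w set \<Rightarrow> ('w \<Rightarrow> real) set set \<Rightarrow> ('w \<Rightarrow> real) set" where
  "gamble_Inter \<Omega> \<R> = gambles \<Omega> \<inter> \<Inter>\<R>"

definition natural_extension :: "'w set \<Rightarrow> ('w \<Rightarrow> real) set \<Rightarrow> ('w \<Rightarrow> real) set" where
  "natural_extension \<Omega> A = gamble_Inter \<Omega> {R. coherent \<Omega> R \<and> A \<subseteq> R}"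


section \<open>Exchangeability\<close>

text \<open>A tuple in \<open>X\<^sup>N\<close> is an extensional function on the index set \<open>{1..N}\<close>.\<close>

definition tuples :: "'a set \<Rightarrow> nat \<Rightarrow> (nat \<Rightarrow> 'a) set" where
  "tuples X N = {1..N} \<rightarrow>\<^sub>E X"

text \<open>
  The permuted tuple \<open>(x\<^bsub>p(1)\<^esub>, \<dots>, x\<^bsub>p(N)\<^esub>)\<close> is \<open>x \<circ> p\<close>. As \<open>p permutes {1..N}\<close> fixes all
  other indices, \<open>x \<circ> p\<close> is a tuple exactly when \<open>x\<close> is, so lifting maps gambles to gambles.
\<close>

definition lift_perm :: "(nat \<Rightarrow> nat) \<Rightarrow> ((nat \<Rightarrow> 'a) \<Rightarrow> real) \<Rightarrow> (nat \<Rightarrow> 'a) \<Rightarrow> real" where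
  "lift_perm p f = f \<circ> (\<lambda>x. x \<circ> p)"

definition exch_avg :: "nat \<Rightarrow> ((nat \<Rightarrow> 'a) \<Rightarrow> real) \<Rightarrow> (nat \<Rightarrow> 'a) \<Rightarrow> real" where
  "exch_avg N f = (\<lambda>x. 1 / fact N * (\<Sum>p | p permutes {1..N}. lift_perm p f x))"

definition D_U :: "'a set \<Rightarrow> nat \<Rightarrow> ((nat \<Rightarrow> 'a) \<Rightarrow> real) set" where
  "D_U X N = {f \<in> gambles (tuples X N). exch_avg N f = 0}"

definition exchangeable :: "'a set \<Rightarrow> nat \<Rightarrow> ((nat \<Rightarrow> 'a) \<Rightarrow> real) set \<Rightarrow> bool" where
  "exchangeable X N R \<longleftrightarrow> D_U X N + R \<subseteq> R"

definition D_ex :: "'a set \<Rightarrow> nat \<Rightarrow> ((nat \<Rightarrow> 'a) \<Rightarrow> real) set set" where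
  "D_ex X N = {R. coherent (tuples X N) R \<and> exchangeable X N R}"

definition avoids_nonpositivity_exch :: "'a set \<Rightarrow> nat \<Rightarrow> ((nat \<Rightarrow> 'a) \<Rightarrow> real) set \<Rightarrow> bool" where
  "avoids_nonpositivity_exch X N A \<longleftrightarrow>
     avoids_nonpositivity ((pos_gambles (tuples X N) \<union> A) + D_U X N)"

definition exch_natural_extension ::
  "'a set \<Rightarrow> nat \<Rightarrow> ((nat \<Rightarrow> 'a) \<Rightarrow> real) set \<Rightarrow> ((nat \<Rightarrow> 'a) \<Rightarrow> real) set" where
  "exch_natural_extension X N A = gamble_Inter (tuples X N) {R \<in> D_ex X N. A \<subseteq> R}"

definition is_smallest_in :: "'b set \<Rightarrow> 'b set set \<Rightarrow> bool" where
  "is_smallest_in S \<S> \<longleftrightarrow> S \<in> \<S> \<and> (\<forall>T\<in>\<S>. S \<subseteq> T)"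

end

theory Submission imports Defs begin

text \<open>
  The set \<open>E = posi (D_U + (pos_gambles \<union> A))\<close> is the least convex cone that contains \<open>A\<close> and the
  positive gambles and absorbs \<open>D_U\<close>, so every coherent exchangeable superset of \<open>A\<close> includes it.
  The only way \<open>E\<close> can fail to be coherent is \<open>0 \<in> E\<close>, which is what avoiding non-positivity
  under exchangeability excludes. Then \<open>E\<close> is itself the smallest coherent exchangeable superset.
\<close>

section \<open>Convex cones of functions and the positive hull \<open>posi\<close>\<close>

text \<open>Only strictly positive scalars are allowed, so a cone may omit 0. Coherent sets, which
  must omit it, therefore qualify.\<close>

definition convex_cone_fun :: "('w \<Rightarrow> real) set \<Rightarrow> bool" where
  "convex_cone_fun C \<longleftrightarrow>
     (\<forall>f\<in>C. \<forall>g\<in>C. f + g \<in> C) \<and> (\<forall>f\<in>C. \<forall>c>0. (\<lambda>\<omega>. c * f \<omega>) \<in> C)"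

lemma convex_cone_funI:
  assumes "\<And>f g. f \<in> C \<Longrightarrow> g \<in> C \<Longrightarrow> f + g \<in> C"
    and "\<And>f c. f \<in> C \<Longrightarrow> c > 0 \<Longrightarrow> (\<lambda>\<omega>. c * f \<omega>) \<in> C"
  shows "convex_cone_fun C"
  using assms by (auto simp: convex_cone_fun_def)

lemma convex_cone_fun_add: "convex_cone_fun C \<Longrightarrow> f \<in> C \<Longrightarrow> g \<in> C \<Longrightarrow> f + g \<in> C"
  by (simp add: convex_cone_fun_def)

lemma convex_cone_fun_scale:
  "convex_cone_fun C \<Longrightarrow> f \<in> C \<Longrightarrow> c > 0 \<Longrightarrow> (\<lambda>\<omega>. c * f \<omega>) \<in> C"
  by (simp add: convex_cone_fun_def)

lemma convex_cone_fun_set_plus: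
  assumes "convex_cone_fun C" "convex_cone_fun D"
  shows "convex_cone_fun (C + D)"
proof (rule convex_cone_funI)
  fix f g assume "f \<in> C + D" "g \<in> C + D"
  then obtain a b a' b' where "f = a + b" "g = a' + b'" "a \<in> C" "b \<in> D" "a' \<in> C" "b' \<in> D"
    by (meson set_plus_elim)
  moreover from this have "(a + a') + (b + b') \<in> C + D"
    using assms by (intro set_plus_intro convex_cone_fun_add)
  ultimately show "f + g \<in> C + D" by (simp add: algebra_simps)
next
  fix f and c :: real assume "f \<in> C + D" and c: "c > 0"
  then obtain a b where f: "f = a + b" "a \<in> C" "b \<in> D"
    by (meson set_plus_elim)
  then have "(\<lambda>\<omega>. c * a \<omega>) + (\<lambda>\<omega>. c * b \<omega>) \<in> C + D"
    using assms c by (intro set_plus_intro convex_cone_fun_scale)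
  moreover have "(\<lambda>\<omega>. c * f \<omega>) = (\<lambda>\<omega>. c * a \<omega>) + (\<lambda>\<omega>. c * b \<omega>)"
    by (simp add: f fun_eq_iff algebra_simps)
  ultimately show "(\<lambda>\<omega>. c * f \<omega>) \<in> C + D" by simp
qed

lemma subset_posi: "A \<subseteq> posi A"
proof
  fix f assume "f \<in> A"
  then show "f \<in> posi A"
    unfolding posi_def
    by (intro CollectI exI[of _ "1::nat"] exI[of _ "\<lambda>_. 1"] exI[of _ "\<lambda>_. f"]) simp
qed

lemma convex_cone_fun_posi: "convex_cone_fun (posi A)"
proof (rule convex_cone_funI)
  fix f g assume "f \<in> posi A" "g \<in> posi A"
  then obtain n m :: nat and l l' u v where
    f: "f = (\<lambda>\<omega>. \<Sum>k=1..n. l k * u k \<omega>)" "n \<ge> 1" "\<forall>k\<in>{1..n}. u k \<in> A \<and> l k > 0" and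
    g: "g = (\<lambda>\<omega>. \<Sum>k=1..m. l' k * v k \<omega>)" "m \<ge> 1" "\<forall>k\<in>{1..m}. v k \<in> A \<and> l' k > 0"
    unfolding posi_def by blast
  \<comment> \<open>The two combinations are concatenated: indices up to \<open>n\<close> carry that
    of \<open>f\<close>, and indices \<open>n+1..n+m\<close> carry that of \<open>g\<close> shifted
    by \<open>n\<close>.\<close>
  define L where "L k = (if k \<le> n then l k else l' (k - n))" for k
  define F where "F k = (if k \<le> n then u k else v (k - n))" for k
  have "(f + g) \<omega> = (\<Sum>k=1..n+m. L k * F k \<omega>)" for \<omega>
  proof -
    have "(\<Sum>k=1..n+m. L k * F k \<omega>)
        = (\<Sum>k=1..n. L k * F k \<omega>) + (\<Sum>k=n+1..n+m. L k * F k \<omega>)"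
      by (rule sum.ub_add_nat) simp
    also have "(\<Sum>k=n+1..n+m. L k * F k \<omega>) = (\<Sum>k=1..m. L (k + n) * F (k + n) \<omega>)"
      using sum.shift_bounds_cl_nat_ivl[of "\<lambda>k. L k * F k \<omega>" 1 n m] by (simp add: add.commute)
    finally show ?thesis
      by (simp add: f(1) g(1) L_def F_def)
  qed
  then have "f + g = (\<lambda>\<omega>. \<Sum>k=1..n+m. L k * F k \<omega>)" ..
  moreover have "\<forall>k\<in>{1..n+m}. F k \<in> A \<and> L k > 0"
  proof
    fix k assume "k \<in> {1..n+m}"
    then show "F k \<in> A \<and> L k > 0"
      using bspec[OF f(3), of k] bspec[OF g(3), of "k - n"]
      by (cases "k \<le> n") (simp_all add: L_def F_def le_diff_conv)
  qed
  ultimately show "f + g \<in> posi A"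
    unfolding posi_def using f(2) trans_le_add1 by blast
next
  fix f and c :: real assume "f \<in> posi A" and c: "c > 0"
  then obtain n :: nat and l u where
    f: "f = (\<lambda>\<omega>. \<Sum>k=1..n. l k * u k \<omega>)" "n \<ge> 1" "\<forall>k\<in>{1..n}. u k \<in> A \<and> l k > 0"
    unfolding posi_def by blast
  have "(\<lambda>\<omega>. c * f \<omega>) = (\<lambda>\<omega>. \<Sum>k=1..n. (c * l k) * u k \<omega>)"
    by (simp add: f(1) sum_distrib_left mult.assoc)
  moreover have "\<forall>k\<in>{1..n}. u k \<in> A \<and> c * l k > 0"
    using f(3) c by simp
  ultimately show "(\<lambda>\<omega>. c * f \<omega>) \<in> posi A"
    unfolding posi_def using f(2)
    by (intro CollectI exI[of _ n] exI[of _ "\<lambda>k. c * l k"] exI[of _ u] conjI)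
qed

text \<open>With \<open>subset_posi\<close> and \<open>convex_cone_fun_posi\<close> this makes
  \<open>posi A\<close> the convex cone generated by \<open>A\<close>. Later inclusions of
  \<open>posi\<close> in another set only need that set to be a cone containing the generators,
  without handling explicit sums.\<close>

lemma posi_least:
  assumes C: "convex_cone_fun C" and AC: "A \<subseteq> C"
  shows "posi A \<subseteq> C"
proof
  fix f assume "f \<in> posi A"
  then obtain n :: nat and l u where
    f: "f = (\<lambda>\<omega>. \<Sum>k=1..n. l k * u k \<omega>)" "n \<ge> 1" "\<forall>k\<in>{1..n}. u k \<in> A \<and> l k > 0"
    unfolding posi_def by blast
  from f(2,3) have "(\<lambda>\<omega>. \<Sum>k=1..n. l k * u k \<omega>) \<in> C"
  \<comment> \<open>The induction starts at one summand, because the empty sum 0 may lie outside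
    \<open>C\<close>.\<close>
  proof (induction n rule: dec_induct)
    case base
    then show ?case using convex_cone_fun_scale[OF C] AC by auto
  next
    case (step n)
    then have "(\<lambda>\<omega>. \<Sum>k=1..n. l k * u k \<omega>) + (\<lambda>\<omega>. l (Suc n) * u (Suc n) \<omega>) \<in> C"
      using AC by (intro convex_cone_fun_add[OF C] convex_cone_fun_scale[OF C]) auto
    then show ?case by (simp add: plus_fun_def)
  qed
  then show "f \<in> C" by (simp add: f)
qed

lemma convex_cone_fun_coherent: "coherent \<Omega> R \<Longrightarrow> convex_cone_fun R"
  by (simp add: coherent_def convex_cone_fun_def)

section \<open>Gambles, coherent sets and the natural extension\<close>

lemma zero_gambles: "0 \<in> gambles \<Omega>"
  by (auto simp: gambles_def image_constant_conv)

lemma gambles_scale: "f \<in> gambles \<Omega> \<Longrightarrow> (\<lambda>\<omega>. c * f \<omega>) \<in> gambles \<Omega>"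
  using bounded_scaling[of "f ` \<Omega>" c] by (auto simp: gambles_def image_image)

lemma gambles_add: "f \<in> gambles \<Omega> \<Longrightarrow> g \<in> gambles \<Omega> \<Longrightarrow> f + g \<in> gambles \<Omega>"
  using bounded_plus_comp[of f \<Omega> g] by (auto simp: gambles_def plus_fun_def)

lemma convex_cone_fun_gambles: "convex_cone_fun (gambles \<Omega>)"
  by (intro convex_cone_funI gambles_add gambles_scale)

text \<open>An intersection of cones is a cone. The factor \<open>gambles \<Omega>\<close> in
  \<open>gamble_Inter\<close> is one too, so the argument also covers an empty family of coherent
  supersets.\<close>

lemma convex_cone_fun_natural_extension: "convex_cone_fun (natural_extension \<Omega> A)"
proof (rule convex_cone_funI)
  fix f g assume "f \<in> natural_extension \<Omega> A" "g \<in> natural_extension \<Omega> A"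
  then show "f + g \<in> natural_extension \<Omega> A"
    unfolding natural_extension_def gamble_Inter_def
    by (auto intro: gambles_add convex_cone_fun_add convex_cone_fun_coherent)
next
  fix f and c :: real assume "f \<in> natural_extension \<Omega> A" "c > 0"
  then show "(\<lambda>\<omega>. c * f \<omega>) \<in> natural_extension \<Omega> A"
    unfolding natural_extension_def gamble_Inter_def
    by (auto intro: gambles_scale convex_cone_fun_scale convex_cone_fun_coherent)
qed

lemma pos_gambles_subset_coherent: "coherent \<Omega> R \<Longrightarrow> pos_gambles \<Omega> \<subseteq> R"
  by (auto simp: coherent_def pos_gambles_def)

lemma subset_natural_extension:
  "A \<subseteq> gambles \<Omega> \<Longrightarrow> pos_gambles \<Omega> \<union> A \<subseteq> natural_extension \<Omega> A"
  using pos_gambles_subset_coherent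
  unfolding natural_extension_def gamble_Inter_def pos_gambles_def by blast

text \<open>If \<open>f \<le> 0\<close> were in \<open>R\<close>, then \<open>f\<close> would be
  nonzero, so \<open>- f\<close> would be a positive gamble and hence in \<open>R\<close>. The sum
  of the two would put 0 in \<open>R\<close>.\<close>

lemma coherent_not_nonpos:
  assumes R: "coherent \<Omega> R" and f: "f \<in> R"
  shows "\<not> f \<le> 0"
proof
  assume "f \<le> 0"
  have "f \<noteq> 0" and fg: "f \<in> gambles \<Omega>"
    using R f by (auto simp: coherent_def)
  with \<open>f \<le> 0\<close> have "- f > 0"
    by (simp add: less_le le_fun_def)
  moreover have "- f \<in> gambles \<Omega>"
    using gambles_scale[OF fg, of "-1"] by (simp add: fun_Compl_def)
  ultimately have "- f \<in> R"
    using R by (simp add: coherent_def)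
  with f R have "f + - f \<in> R"
    unfolding coherent_def by blast
  with R show False by (simp add: coherent_def)
qed

section \<open>The space \<open>D_U\<close> and absorption of its elements\<close>

lemma exch_avg_add: "exch_avg N (f + g) = exch_avg N f + exch_avg N g"
  by (simp add: exch_avg_def lift_perm_def fun_eq_iff sum.distrib ring_distribs)

lemma exch_avg_scale: "exch_avg N (\<lambda>x. c * f x) = (\<lambda>x. c * exch_avg N f x)"
  by (simp add: exch_avg_def lift_perm_def fun_eq_iff sum_distrib_left mult_ac)

lemma zero_D_U: "0 \<in> D_U X N"
  by (simp add: D_U_def zero_gambles exch_avg_def lift_perm_def fun_eq_iff)

lemma convex_cone_fun_D_U: "convex_cone_fun (D_U X N)"
proof (rule convex_cone_funI)
  fix f g :: "(nat \<Rightarrow> 'a) \<Rightarrow> real" assume "f \<in> D_U X N" "g \<in> D_U X N"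
  then show "f + g \<in> D_U X N"
    by (simp add: D_U_def gambles_add exch_avg_add)
next
  fix f :: "(nat \<Rightarrow> 'a) \<Rightarrow> real" and c :: real assume "f \<in> D_U X N"
  then show "(\<lambda>x. c * f x) \<in> D_U X N"
    by (simp add: D_U_def gambles_scale exch_avg_scale zero_fun_def)
qed

lemma subset_set_plus_D_U: "B \<subseteq> D_U X N + B"
proof
  fix f assume "f \<in> B"
  from set_plus_intro[OF zero_D_U this] show "f \<in> D_U X N + B" by simp
qed

text \<open>This is what makes the positive hull exchangeable. The functions all of whose translates
  by \<open>D_U\<close> stay in the hull form a cone \<open>C\<close>. As \<open>D_U\<close> is
  closed under addition, \<open>C\<close> contains the generators \<open>D_U X N + B\<close>, and
  \<open>posi_least\<close> applies.\<close>

lemma D_U_plus_posi_subset: "D_U X N + posi (D_U X N + B) \<subseteq> posi (D_U X N + B)"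
proof -
  let ?D = "D_U X N" let ?E = "posi (D_U X N + B)"
  define C where "C = {f. \<forall>d\<in>?D. d + f \<in> ?E}"
  have E: "convex_cone_fun ?E" by (rule convex_cone_fun_posi)
  have "convex_cone_fun C"
  proof (rule convex_cone_funI)
    fix f g assume "f \<in> C" "g \<in> C"
    \<comment> \<open>The whole translation \<open>d\<close> is charged to \<open>f\<close>, while
      \<open>g\<close> is translated by 0.\<close>
    then have "d + f \<in> ?E" "0 + g \<in> ?E" if "d \<in> ?D" for d
      using that zero_D_U unfolding C_def by blast+
    from convex_cone_fun_add[OF E this] show "f + g \<in> C"
      by (simp add: C_def add.assoc)
  next
    fix f and c :: real assume f: "f \<in> C" and c: "c > 0"
    show "(\<lambda>\<omega>. c * f \<omega>) \<in> C"
      unfolding C_def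
    proof (intro CollectI ballI)
      fix d assume "d \<in> ?D"
      \<comment> \<open>The identity \<open>d + c * f = c * ((1 / c) * d + f)\<close> moves the
        translation inside the scaling.\<close>
      then have "(\<lambda>\<omega>. (1 / c) * d \<omega>) \<in> ?D"
        using c by (intro convex_cone_fun_scale[OF convex_cone_fun_D_U]) auto
      then have "(\<lambda>\<omega>. (1 / c) * d \<omega>) + f \<in> ?E"
        using f by (simp add: C_def)
      from convex_cone_fun_scale[OF E this c] show "d + (\<lambda>\<omega>. c * f \<omega>) \<in> ?E"
        using c by (simp add: plus_fun_def distrib_left)
    qed
  qed
  moreover have "?D + B \<subseteq> C"
  proof
    fix f assume "f \<in> ?D + B"
    then obtain d b where f: "f = d + b" "d \<in> ?D" "b \<in> B"
      by (meson set_plus_elim)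
    then have "(d' + d) + b \<in> ?D + B" if "d' \<in> ?D" for d'
      using that convex_cone_fun_add[OF convex_cone_fun_D_U] by (intro set_plus_intro) auto
    then show "f \<in> C"
      using subset_posi[of "?D + B"] by (auto simp: C_def f add.assoc)
  qed
  ultimately have "?E \<subseteq> C" by (rule posi_least)
  then show ?thesis by (auto simp: C_def elim!: set_plus_elim)
qed

section \<open>The positive hull as the exchangeable natural extension\<close>

lemma posi_D_U_subset_D_ex:
  assumes R: "R \<in> D_ex X N" and AR: "A \<subseteq> R"
  shows "posi (D_U X N + (pos_gambles (tuples X N) \<union> A)) \<subseteq> R"
proof (rule posi_least)
  have coh: "coherent (tuples X N) R" and ex: "D_U X N + R \<subseteq> R"
    using R by (auto simp: D_ex_def exchangeable_def)
  show "convex_cone_fun R" using coh by (rule convex_cone_fun_coherent)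
  have "pos_gambles (tuples X N) \<union> A \<subseteq> R"
    using pos_gambles_subset_coherent[OF coh] AR by simp
  then show "D_U X N + (pos_gambles (tuples X N) \<union> A) \<subseteq> R"
    using ex set_plus_mono2[OF order_refl] by blast
qed

text \<open>The positive hull lies inside \<open>R\<close>, and a coherent set has no non-positive
  member.\<close>

lemma D_ex_imp_avoids_nonpositivity_exch:
  assumes "R \<in> D_ex X N" and "A \<subseteq> R"
  shows "avoids_nonpositivity_exch X N A"
proof -
  have "coherent (tuples X N) R"
    using assms(1) by (simp add: D_ex_def)
  then show ?thesis
    using posi_D_U_subset_D_ex[OF assms] coherent_not_nonpos
    unfolding avoids_nonpositivity_exch_def avoids_nonpositivity_def
    by (metis add.commute subsetD)
qed

lemma posi_D_U_in_D_ex: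
  assumes A: "A \<subseteq> gambles (tuples X N)" and avoid: "avoids_nonpositivity_exch X N A"
  shows "posi (D_U X N + (pos_gambles (tuples X N) \<union> A)) \<in> D_ex X N"
proof -
  let ?\<Omega> = "tuples X N"
  let ?B = "pos_gambles ?\<Omega> \<union> A"
  let ?E = "posi (D_U X N + ?B)"
  have BE: "?B \<subseteq> ?E"
    using subset_set_plus_D_U subset_posi by (rule order_trans)
  have "?B \<subseteq> gambles ?\<Omega>"
    using A by (auto simp: pos_gambles_def)
  then have "D_U X N + ?B \<subseteq> gambles ?\<Omega>"
    by (auto simp: D_U_def elim!: set_plus_elim intro: gambles_add)
  then have "?E \<subseteq> gambles ?\<Omega>"
    by (rule posi_least[OF convex_cone_fun_gambles])
  \<comment> \<open>If 0 belonged to the hull, it would itself be a forbidden non-positive element.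
    The definition of avoidance writes \<open>D_U\<close> as the right summand, hence
    \<open>add.commute\<close>.\<close>
  moreover have "0 \<notin> ?E"
    using avoid unfolding avoids_nonpositivity_exch_def avoids_nonpositivity_def
    by (metis add.commute order_refl)
  moreover have "f \<in> ?E" if "f \<in> gambles ?\<Omega>" "f > 0" for f
    using BE that by (auto simp: pos_gambles_def)
  ultimately have "coherent ?\<Omega> ?E"
    using convex_cone_fun_posi[of "D_U X N + ?B"]
    by (simp add: coherent_def convex_cone_fun_def)
  then show ?thesis
    using D_U_plus_posi_subset by (simp add: D_ex_def exchangeable_def)
qed

text \<open>The hull is one of the sets being intersected and is included in each of them.\<close>

lemma exch_natural_extension_eq_posi:
  assumes "A \<subseteq> gambles (tuples X N)" and "avoids_nonpositivity_exch X N A"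
  shows "exch_natural_extension X N A = posi (D_U X N + (pos_gambles (tuples X N) \<union> A))"
    (is "_ = ?E")
proof
  have E: "?E \<in> D_ex X N" by (rule posi_D_U_in_D_ex[OF assms])
  have "A \<subseteq> ?E"
    using order_trans[OF subset_set_plus_D_U subset_posi] by blast
  with E show "exch_natural_extension X N A \<subseteq> ?E"
    by (auto simp: exch_natural_extension_def gamble_Inter_def)
  have "?E \<subseteq> gambles (tuples X N)"
    using E by (simp add: D_ex_def coherent_def)
  then show "?E \<subseteq> exch_natural_extension X N A"
    using posi_D_U_subset_D_ex unfolding exch_natural_extension_def gamble_Inter_def by blast
qed

text \<open>From left to right, the sum of two cones is a cone, and it contains the generators. From
  right to left, the hull is a coherent superset of \<open>A\<close>, so it includes the natural
  extension, and it absorbs \<open>D_U\<close>.\<close>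

lemma posi_D_U_eq_D_U_plus_natural_extension:
  assumes A: "A \<subseteq> gambles (tuples X N)" and "avoids_nonpositivity_exch X N A"
  shows "posi (D_U X N + (pos_gambles (tuples X N) \<union> A))
    = D_U X N + natural_extension (tuples X N) A" (is "?E = _")
proof
  show "?E \<subseteq> D_U X N + natural_extension (tuples X N) A"
    by (intro posi_least convex_cone_fun_set_plus convex_cone_fun_D_U
        convex_cone_fun_natural_extension set_plus_mono2 order_refl subset_natural_extension A)
  have "A \<subseteq> ?E"
    using order_trans[OF subset_set_plus_D_U subset_posi] by blast
  then have "natural_extension (tuples X N) A \<subseteq> ?E"
    using posi_D_U_in_D_ex[OF assms]
    by (auto simp: natural_extension_def gamble_Inter_def D_ex_def)
  then show "D_U X N + natural_extension (tuples X N) A \<subseteq> ?E"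
    using D_U_plus_posi_subset set_plus_mono2[OF order_refl] by blast
qed

theorem theorem13:
  fixes X :: "'a set" and N :: nat and A :: "((nat \<Rightarrow> 'a) \<Rightarrow> real) set"
  assumes "finite X" and "X \<noteq> {}" and "N \<ge> 1"
    and "A \<subseteq> gambles (tuples X N)"
  shows
    "(avoids_nonpositivity_exch X N A
        \<longleftrightarrow> (\<exists>R \<in> D_ex X N. A \<subseteq> R)) \<and>
     ((\<exists>R \<in> D_ex X N. A \<subseteq> R)
        \<longleftrightarrow> exch_natural_extension X N A \<noteq> gambles (tuples X N)) \<and>
     (exch_natural_extension X N A \<noteq> gambles (tuples X N)
        \<longleftrightarrow> exch_natural_extension X N A \<in> D_ex X N) \<and>
     (exch_natural_extension X N A \<in> D_ex X N
        \<longleftrightarrow> is_smallest_in (exch_natural_extension X N A) {R \<in> D_ex X N. A \<subseteq> R}) \<and>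
     (avoids_nonpositivity_exch X N A \<longrightarrow>
        exch_natural_extension X N A = posi (D_U X N + (pos_gambles (tuples X N) \<union> A)) \<and>
        posi (D_U X N + (pos_gambles (tuples X N) \<union> A))
          = D_U X N + natural_extension (tuples X N) A)"
proof -
  let ?G = "gambles (tuples X N)" and ?F = "exch_natural_extension X N A"
  let ?ii = "\<exists>R \<in> D_ex X N. A \<subseteq> R"
  have AF: "A \<subseteq> ?F"
    using assms(4) by (auto simp: exch_natural_extension_def gamble_Inter_def)
  have i_iv: "?F \<in> D_ex X N" if "avoids_nonpositivity_exch X N A"
    using exch_natural_extension_eq_posi posi_D_U_in_D_ex assms(4) that by metis
  have ii_i: "avoids_nonpositivity_exch X N A" if ?ii
    using that D_ex_imp_avoids_nonpositivity_exch by blast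
  have iv_ii: ?ii if "?F \<in> D_ex X N"
    using that AF by blast
  \<comment> \<open>Without a coherent exchangeable superset the intersection is over the empty
    family, which by convention gives all gambles.\<close>
  have iii_ii: ?ii if "?F \<noteq> ?G"
    using that by (auto simp: exch_natural_extension_def gamble_Inter_def)
  \<comment> \<open>The gamble 0 separates the two sets, since no coherent set contains it.\<close>
  have iv_iii: "?F \<noteq> ?G" if "?F \<in> D_ex X N"
    using that zero_gambles[of "tuples X N"] by (auto simp: D_ex_def coherent_def)
  \<comment> \<open>An intersection is automatically included in every member of its family, and it
    includes \<open>A\<close> by \<open>AF\<close>, so being smallest reduces to membership in
    \<open>D_ex X N\<close>.\<close>
  have iv_v: "is_smallest_in ?F {R \<in> D_ex X N. A \<subseteq> R} \<longleftrightarrow> ?F \<in> D_ex X N"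
    using AF by (auto simp: is_smallest_in_def exch_natural_extension_def gamble_Inter_def)
  show ?thesis
    using i_iv ii_i iv_ii iii_ii iv_iii iv_v exch_natural_extension_eq_posi[OF assms(4)]
      posi_D_U_eq_D_U_plus_natural_extension[OF assms(4)] by blast
qed

end
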